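(* Let $\kappa$ be a cardinal and assume $\mathbf{MA}_\kappa(\mathbb{Q}_\circledcirc)$. Suppose $\mathbb{P}$ is a forcing notion with $|\mathbb{P}|\le\kappa$ and $\Vdash_{\mathbb{P}} 2^\omega\cap\mathbf{V}\neq 2^\omega$ (i.e. the complete Boolean algebra $\mathrm{RO}(\mathbb{P})$ is not $(\omega,\omega)$-distributive). Then $\mathbb{P}$ adds a real in $\omega^\omega$ unbounded over $\mathbf{V}$.
   Context: $\mathbb{Q}_\circledcirc$ is the forcing notion whose conditions are pairs $\langle a,w\rangle$ with $w$ a finite subset of $2^\omega$ and $a$ a finite subset of $2^{<\omega}$, ordered by $\langle a_0,w_0\rangle\le\langle a_1,w_1\rangle$ iff $a_0\subseteq a_1$, $w_0\subseteq w_1$, and for all $\eta\in w_0$, $l\in\omega$: $\eta\restriction l\in a_1\Rightarrow \eta\restriction l\in a_0$ (stronger conditions are greater). $\mathbf{MA}_\kappa(\mathbb{Q})$: for any $\kappa$ maximal antichains of $\mathbb{Q}$ and any $p\in\mathbb{Q}$ there is a filter containing $p$ meeting all of them. A real is unbounded over $\mathbf{V}$ if it is not eventually dominated by any ground-model function in $\omega^\omega$. *)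

theory Defs
  imports Main
begin

unbundle cardinal_syntax

section \<open>Forcing notions\<close>

text \<open>
  A forcing notion is a nonempty preorder, represented by its relation; its set of conditions is
  the field of the relation.  \<open>(p, q) \<in> P\<close> reads "\<open>p \<le> q\<close>", and \<^emph>\<open>stronger conditions are
  greater\<close>.
\<close>

definition forcing_notion :: "'p rel \<Rightarrow> bool" where
  "forcing_notion P \<longleftrightarrow> Preorder P \<and> Field P \<noteq> {}"

definition compatible :: "'p rel \<Rightarrow> 'p \<Rightarrow> 'p \<Rightarrow> bool" where
  "compatible P p q \<longleftrightarrow> (\<exists>r. (p, r) \<in> P \<and> (q, r) \<in> P)"

definition antichain :: "'p rel \<Rightarrow> 'p set \<Rightarrow> bool" where
  "antichain P A \<longleftrightarrow> A \<subseteq> Field P \<and> pairwise (\<lambda>p q. \<not> compatible P p q) A"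

definition maximal_antichain :: "'p rel \<Rightarrow> 'p set \<Rightarrow> bool" where
  "maximal_antichain P A \<longleftrightarrow> antichain P A \<and> (\<forall>B. antichain P B \<and> A \<subseteq> B \<longrightarrow> B = A)"

definition forcing_filter :: "'p rel \<Rightarrow> 'p set \<Rightarrow> bool" where
  "forcing_filter P F \<longleftrightarrow>
     F \<noteq> {} \<and> F \<subseteq> Field P \<and>
     (\<forall>p q. q \<in> F \<and> (p, q) \<in> P \<longrightarrow> p \<in> F) \<and>
     (\<forall>p\<in>F. \<forall>q\<in>F. \<exists>r\<in>F. (p, r) \<in> P \<and> (q, r) \<in> P)"

definition MA :: "'k rel \<Rightarrow> 'q rel \<Rightarrow> bool" where
  "MA \<kappa> Q \<longleftrightarrow>
     (\<forall>\<A>. |\<A>| \<le>o \<kappa> \<and> (\<forall>A\<in>\<A>. maximal_antichain Q A) \<longrightarrow>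
       (\<forall>p\<in>Field Q. \<exists>F. forcing_filter Q F \<and> p \<in> F \<and> (\<forall>A\<in>\<A>. F \<inter> A \<noteq> {})))"


section \<open>The forcing notion \<open>Q\<^sub>\<circledcirc>\<close>\<close>

definition restr :: "(nat \<Rightarrow> 'v) \<Rightarrow> nat \<Rightarrow> 'v list" where
  "restr \<eta> l = map \<eta> [0..<l]"

definition Q_circledcirc :: "(bool list set \<times> (nat \<Rightarrow> bool) set) rel" where
  "Q_circledcirc = {((a0, w0), (a1, w1)).
     finite a0 \<and> finite w0 \<and> finite a1 \<and> finite w1 \<and>
     a0 \<subseteq> a1 \<and> w0 \<subseteq> w1 \<and> (\<forall>\<eta>\<in>w0. \<forall>l. restr \<eta> l \<in> a1 \<longrightarrow> restr \<eta> l \<in> a0)}"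

lemma Field_Q_circledcirc: "Field Q_circledcirc = {(a, w). finite a \<and> finite w}"
  by (force simp: Field_def Q_circledcirc_def)

lemma forcing_notion_Q_circledcirc: "forcing_notion Q_circledcirc"
proof -
  have "Q_circledcirc \<subseteq> Field Q_circledcirc \<times> Field Q_circledcirc"
    by (auto simp: Field_def)
  moreover have "refl_on (Field Q_circledcirc) Q_circledcirc"
    unfolding Field_Q_circledcirc by (auto simp: refl_on_def Q_circledcirc_def)
  moreover have "trans Q_circledcirc"
    by (rule transI) (fastforce simp: Q_circledcirc_def)
  moreover have "({}, {}) \<in> Field Q_circledcirc"
    by (simp add: Field_Q_circledcirc)
  ultimately show ?thesis
    unfolding forcing_notion_def preorder_on_def by blast
qed


section \<open>The forcing relation\<close>

text \<open>
  The forcing relation is embedded shallowly: a sentence of the forcing language of \<open>P\<close> is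
  represented by the set of conditions forcing it, and each operator below is the usual recursive
  clause of the definition of forcing.  The ambient universe of HOL is the ground model \<open>V\<close>.

  The only names needed are those for subsets of \<open>\<omega> \<times> Y\<close>, with \<open>Y\<close> a ground model set (here a type
  \<^typ>\<open>'v\<close>): such a name \<open>\<tau>\<close> is a set of pairs \<open>(x, s)\<close>, with \<open>x\<close> standing for its canonical name and
  \<open>s\<close> a condition, and a generic filter \<open>G\<close> interprets it as \<open>{x. \<exists>s\<in>G. (x, s) \<in> \<tau>}\<close>.  Every subset
  of \<open>\<omega> \<times> Y\<close> in the extension has a name of this form, so quantifying over these names is
  quantifying over all subsets of \<open>\<omega> \<times> Y\<close> of the extension.
\<close>

type_synonym ('v, 'p) rname = "((nat \<times> 'v) \<times> 'p) set"

definition rnames :: "'p rel \<Rightarrow> ('v, 'p) rname set" where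
  "rnames P = Pow (UNIV \<times> Field P)"

definition dense_above :: "'p rel \<Rightarrow> 'p \<Rightarrow> 'p set \<Rightarrow> bool" where
  "dense_above P p D \<longleftrightarrow> (\<forall>q. (p, q) \<in> P \<longrightarrow> (\<exists>r\<in>D. (q, r) \<in> P))"

definition fr_mem :: "'p rel \<Rightarrow> nat \<times> 'v \<Rightarrow> ('v, 'p) rname \<Rightarrow> 'p set" where
  "fr_mem P x \<tau> = {p \<in> Field P. dense_above P p {q. \<exists>s. (x, s) \<in> \<tau> \<and> (s, q) \<in> P}}"

definition fr_not :: "'p rel \<Rightarrow> 'p set \<Rightarrow> 'p set" where
  "fr_not P \<phi> = {p \<in> Field P. \<forall>q. (p, q) \<in> P \<longrightarrow> q \<notin> \<phi>}"

definition fr_and :: "'p set \<Rightarrow> 'p set \<Rightarrow> 'p set" where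
  "fr_and \<phi> \<psi> = \<phi> \<inter> \<psi>"

text \<open>
  The quantifiers range over a set \<open>S\<close> of names: either \<^const>\<open>rnames\<close>, or canonical names of
  ground model objects, in which case it is the objects themselves that are collected in \<open>S\<close>.
\<close>

definition fr_all :: "'p rel \<Rightarrow> 'i set \<Rightarrow> ('i \<Rightarrow> 'p set) \<Rightarrow> 'p set" where
  "fr_all P S \<Phi> = {p \<in> Field P. \<forall>x\<in>S. p \<in> \<Phi> x}"

definition fr_ex :: "'p rel \<Rightarrow> 'i set \<Rightarrow> ('i \<Rightarrow> 'p set) \<Rightarrow> 'p set" where
  "fr_ex P S \<Phi> = {p \<in> Field P. dense_above P p {q. \<exists>x\<in>S. q \<in> \<Phi> x}}"

definition forced :: "'p rel \<Rightarrow> 'p set \<Rightarrow> bool" where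
  "forced P \<phi> \<longleftrightarrow> (\<forall>p\<in>Field P. p \<in> \<phi>)"


section \<open>New reals and unbounded reals\<close>

text \<open>"\<open>\<tau>\<close> is a function from \<open>\<omega>\<close> to \<open>Y\<close>", where \<open>Y\<close> is the ground model set \<^typ>\<open>'v\<close>.\<close>

definition fr_function :: "'p rel \<Rightarrow> ('v, 'p) rname \<Rightarrow> 'p set" where
  "fr_function P \<tau> =
     fr_and
       (fr_all P UNIV (\<lambda>n. fr_ex P UNIV (\<lambda>y. fr_mem P (n, y) \<tau>)))
       (fr_all P UNIV (\<lambda>n. fr_all P {(y, z). y \<noteq> z} (\<lambda>(y, z).
          fr_not P (fr_and (fr_mem P (n, y) \<tau>) (fr_mem P (n, z) \<tau>)))))"

text \<open>"\<open>\<tau> \<in> V\<close>", for a function \<open>\<tau>\<close> with domain \<open>\<omega>\<close>.\<close>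

definition fr_in_ground :: "'p rel \<Rightarrow> ('v, 'p) rname \<Rightarrow> 'p set" where
  "fr_in_ground P \<tau> =
     fr_ex P (UNIV :: (nat \<Rightarrow> 'v) set) (\<lambda>x. fr_all P UNIV (\<lambda>n. fr_mem P (n, x n) \<tau>))"

text \<open>"\<open>\<tau>(n) \<le> g(n)\<close> for all but finitely many \<open>n\<close>", for \<open>\<tau> \<in> \<omega>\<^sup>\<omega>\<close> and \<open>g\<close> in the ground model.\<close>

definition fr_dominated :: "'p rel \<Rightarrow> (nat, 'p) rname \<Rightarrow> (nat \<Rightarrow> nat) \<Rightarrow> 'p set" where
  "fr_dominated P \<tau> g =
     fr_ex P UNIV (\<lambda>k. fr_all P {k..} (\<lambda>n. fr_ex P {..g n} (\<lambda>m. fr_mem P (n, m) \<tau>)))"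

text \<open>\<open>P\<close> forces \<open>2\<^sup>\<omega> \<inter> V \<noteq> 2\<^sup>\<omega>\<close>.\<close>

definition adds_new_real :: "'p rel \<Rightarrow> bool" where
  "adds_new_real P \<longleftrightarrow>
     forced P (fr_ex P (rnames P :: (bool, 'p) rname set)
       (\<lambda>\<tau>. fr_and (fr_function P \<tau>) (fr_not P (fr_in_ground P \<tau>))))"

text \<open>\<open>P\<close> forces that some real in \<open>\<omega>\<^sup>\<omega>\<close> is unbounded over \<open>V\<close>.\<close>

definition adds_unbounded_real :: "'p rel \<Rightarrow> bool" where
  "adds_unbounded_real P \<longleftrightarrow>
     forced P (fr_ex P (rnames P :: (nat, 'p) rname set)
       (\<lambda>\<tau>. fr_and (fr_function P \<tau>)
          (fr_not P (fr_ex P (UNIV :: (nat \<Rightarrow> nat) set) (fr_dominated P \<tau>)))))"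

end

theory Submission
  imports Defs
begin

text \<open>
  Let \<open>\<tau>\<close> be a name for a new real below \<open>q\<close>.  For each \<open>p \<ge> q\<close> fix a ground model branch
  \<open>\<eta>\<^sub>p\<close> through the tree of possible initial segments of \<open>\<tau>\<close> below \<open>p\<close>.  Meeting one dense set per
  condition \<open>p\<close>, \<open>MA\<close> yields a set \<open>A \<subseteq> 2\<^sup><\<^sup>\<omega>\<close> containing only finitely many initial segments of
  each \<open>\<eta>\<^sub>p\<close>, but such that infinitely many initial segments of \<open>\<tau>\<close> are forced to lie in \<open>A\<close>.
  The function sending \<open>n\<close> to the least \<open>m \<ge> n\<close> with \<open>\<tau>\<restriction>m \<in> A\<close> is then unbounded: if \<open>p\<close> forced it
  to be bounded by \<open>g\<close> from some point on, then \<open>\<eta>\<^sub>p\<close> would have infinitely many initial segments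
  in \<open>A\<close>, because each \<open>\<eta>\<^sub>p\<restriction>(g n)\<close> is a possible initial segment of \<open>\<tau>\<close> below \<open>p\<close>.
\<close>

section \<open>Preorders, antichains and Martin's axiom for dense sets\<close>

lemma forcing_notionD:
  assumes "forcing_notion P"
  shows forcing_refl: "p \<in> Field P \<Longrightarrow> (p, p) \<in> P"
    and forcing_trans: "(p, r) \<in> P \<Longrightarrow> (r, s) \<in> P \<Longrightarrow> (p, s) \<in> P"
  using assms unfolding forcing_notion_def preorder_on_def
  by (auto dest: refl_onD transD)

text \<open>Zorn gives an antichain \<open>A\<close> that is maximal among those inside
  \<open>D\<close>. If some \<open>b\<close> could still be added, density gives \<open>d\<close> in
  \<open>D\<close> above \<open>b\<close>. Since \<open>d\<close> is stronger than \<open>b\<close>,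
  it is incompatible with all of \<open>A\<close>, so \<open>A\<close> could be enlarged inside
  \<open>D\<close>.\<close>

lemma dense_contains_maximal_antichain:
  assumes Q: "forcing_notion Q" and D: "D \<subseteq> Field Q"
    and dense: "\<And>p. p \<in> Field Q \<Longrightarrow> \<exists>d\<in>D. (p, d) \<in> Q"
  shows "\<exists>A\<subseteq>D. maximal_antichain Q A"
proof -
  let ?S = "{A. A \<subseteq> D \<and> antichain Q A}"
  have "\<exists>M\<in>?S. \<forall>X\<in>?S. M \<subseteq> X \<longrightarrow> X = M"
  proof (rule subset_Zorn_nonempty)
    have "{} \<in> ?S" by (simp add: antichain_def)
    then show "?S \<noteq> {}" by blast
  next
    fix C assume "C \<noteq> {}" and C: "subset.chain ?S C"
    have "\<Union>C \<subseteq> D" using C by (auto simp: subset.chain_def)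
    moreover have "pairwise (\<lambda>p q. \<not> compatible Q p q) (\<Union>C)"
    proof (rule pairwiseI)
      fix p q assume "p \<in> \<Union>C" "q \<in> \<Union>C" and "p \<noteq> q"
      then obtain X Y where XY: "X \<in> C" "p \<in> X" "Y \<in> C" "q \<in> Y" by blast
      then have "X \<subseteq> Y \<or> Y \<subseteq> X" using C by (auto simp: subset_chain_def)
      then obtain Z where "Z \<in> C" "p \<in> Z" "q \<in> Z" using XY by blast
      moreover from this have "antichain Q Z" using C by (auto simp: subset.chain_def)
      ultimately show "\<not> compatible Q p q"
        using \<open>p \<noteq> q\<close> by (auto simp: antichain_def pairwise_def)
    qed
    ultimately show "\<Union>C \<in> ?S" using D by (auto simp: antichain_def)
  qed
  then obtain A where "A \<in> ?S" and max: "\<forall>X\<in>?S. A \<subseteq> X \<longrightarrow> X = A"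
    by (rule bexE)
  then have A: "A \<subseteq> D" "antichain Q A" by auto
  have "B = A" if B: "antichain Q B" and "A \<subseteq> B" for B
  proof (rule ccontr)
    assume "B \<noteq> A"
    then obtain b where b: "b \<in> B" "b \<notin> A" using \<open>A \<subseteq> B\<close> by blast
    then have "b \<in> Field Q" using B by (auto simp: antichain_def)
    then obtain d where d: "d \<in> D" "(b, d) \<in> Q" using dense by blast
    have incomp: "\<not> compatible Q a d" "\<not> compatible Q d a" if "a \<in> A" for a
    proof -
      have "a \<in> B" "a \<noteq> b" using that b \<open>A \<subseteq> B\<close> by auto
      then have "\<not> compatible Q a b" using B b by (auto simp: antichain_def pairwise_def)
      then show "\<not> compatible Q a d" "\<not> compatible Q d a"
        using forcing_trans[OF Q d(2)] unfolding compatible_def by blast+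
    qed
    have "antichain Q (insert d A)"
      using A d D incomp by (auto simp: antichain_def pairwise_insert)
    then have "insert d A = A" using max A(1) d(1) by (simp add: subset_insertI)
    then have "d \<in> A" by blast
    moreover have "compatible Q d d"
      using d D forcing_refl[OF Q] by (auto simp: compatible_def)
    ultimately show False using incomp by blast
  qed
  then show ?thesis using A by (auto simp: maximal_antichain_def)
qed

text \<open>Turns \<open>MA\<close>, which speaks of maximal antichains, into its dense-set form: a
  filter that meets a maximal antichain chosen inside \<open>D i\<close> meets
  \<open>D i\<close>.\<close>

lemma MA_dense_filter:
  assumes MA: "MA \<kappa> Q" and Q: "forcing_notion Q" and I: "|I| \<le>o \<kappa>"
    and D: "\<And>i. i \<in> I \<Longrightarrow> D i \<subseteq> Field Q"
    and dense: "\<And>i p. i \<in> I \<Longrightarrow> p \<in> Field Q \<Longrightarrow> \<exists>d\<in>D i. (p, d) \<in> Q"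
  shows "\<exists>F. forcing_filter Q F \<and> (\<forall>i\<in>I. F \<inter> D i \<noteq> {})"
proof -
  have "\<forall>i\<in>I. \<exists>A\<subseteq>D i. maximal_antichain Q A"
    using dense_contains_maximal_antichain[OF Q D dense] by blast
  then obtain A where A: "\<And>i. i \<in> I \<Longrightarrow> A i \<subseteq> D i \<and> maximal_antichain Q (A i)"
    by metis
  have "|A ` I| \<le>o \<kappa>" using card_of_image I by (rule ordLeq_transitive)
  moreover have "\<forall>X\<in>A ` I. maximal_antichain Q X" using A by blast
  ultimately have "\<forall>p\<in>Field Q. \<exists>F. forcing_filter Q F \<and> p \<in> F \<and> (\<forall>X\<in>A ` I. F \<inter> X \<noteq> {})"
    by (intro MA[unfolded MA_def, THEN spec, THEN mp] conjI)
  moreover have "Field Q \<noteq> {}" using Q by (simp add: forcing_notion_def)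
  ultimately obtain F where F: "forcing_filter Q F" "\<forall>X\<in>A ` I. F \<inter> X \<noteq> {}" by blast
  then have "\<forall>i\<in>I. F \<inter> D i \<noteq> {}" using A by blast
  then show ?thesis using F by blast
qed

section \<open>Initial segments and filters of \<open>Q_circledcirc\<close>\<close>

lemma restr_eq_iff: "restr x l = restr y m \<longleftrightarrow> l = m \<and> (\<forall>i<l. x i = y i)"
proof (cases "l = m")
  case False
  have "length (restr x l) = l" "length (restr y m) = m" by (simp_all add: restr_def)
  then show ?thesis using False by metis
qed (auto simp: restr_def)

text \<open>Once \<eta> belongs to \<open>w\<close>, the order forbids new initial segments of
  \<eta>. Any other member of the filter has a common extension with \<open>(a, w)\<close>, so its
  initial segments of \<eta> already lie in the finite set \<open>a\<close>.\<close>

lemma Q_circledcirc_filter_finite: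
  assumes F: "forcing_filter Q_circledcirc F" and "(a, w) \<in> F" "\<eta> \<in> w"
  shows "\<exists>N. \<forall>l. restr \<eta> l \<in> (\<Union>(a', w')\<in>F. a') \<longrightarrow> l < N"
proof -
  have "finite a" using assms
    by (auto simp: forcing_filter_def Field_Q_circledcirc)
  then obtain N where N: "\<forall>n\<in>length ` a. n < N"
    using finite_nat_set_iff_bounded[of "length ` a"] by blast
  have "l < N" if l: "restr \<eta> l \<in> (\<Union>(a', w')\<in>F. a')" for l
  proof -
    obtain a' w' where aw': "(a', w') \<in> F" "restr \<eta> l \<in> a'" using l by blast
    then obtain c where "((a, w), c) \<in> Q_circledcirc" "((a', w'), c) \<in> Q_circledcirc"
      using F \<open>(a, w) \<in> F\<close> unfolding forcing_filter_def by blast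
    then have "restr \<eta> l \<in> a"
      using aw' \<open>\<eta> \<in> w\<close> by (cases c) (auto simp: Q_circledcirc_def)
    then have "length (restr \<eta> l) < N" using N by blast
    then show ?thesis by (simp add: restr_def)
  qed
  then show ?thesis by blast
qed

section \<open>Basic rules of the forcing relation\<close>

lemma fr_mem_mono:
  assumes P: "forcing_notion P" and "p \<in> fr_mem P x \<tau>" "(p, r) \<in> P"
  shows "r \<in> fr_mem P x \<tau>"
proof -
  have "dense_above P p {u. \<exists>s. (x, s) \<in> \<tau> \<and> (s, u) \<in> P}" using assms(2) by (simp add: fr_mem_def)
  then have "dense_above P r {u. \<exists>s. (x, s) \<in> \<tau> \<and> (s, u) \<in> P}"
    using forcing_trans[OF P assms(3)] by (simp add: dense_above_def)
  then show ?thesis using FieldI2[OF assms(3)] by (simp add: fr_mem_def)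
qed

lemma fr_memI:
  assumes P: "forcing_notion P" and "(x, s) \<in> \<tau>" "(s, p) \<in> P"
  shows "p \<in> fr_mem P x \<tau>"
proof -
  have "\<exists>r\<in>{q. \<exists>s. (x, s) \<in> \<tau> \<and> (s, q) \<in> P}. (u, r) \<in> P" if "(p, u) \<in> P" for u
    using assms(2) forcing_trans[OF P assms(3) that] forcing_refl[OF P FieldI2[OF that]] by blast
  then show ?thesis using FieldI2[OF assms(3)] by (simp add: fr_mem_def dense_above_def)
qed

lemma fr_memE:
  assumes P: "forcing_notion P" and "p \<in> fr_mem P x \<tau>"
  obtains s t where "(x, s) \<in> \<tau>" "(s, t) \<in> P" "(p, t) \<in> P"
proof -
  have "(p, p) \<in> P" using assms by (simp add: fr_mem_def forcing_refl)
  then show ?thesis using assms(2) that unfolding fr_mem_def dense_above_def by blast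
qed

lemma fr_exI:
  assumes "p \<in> Field P" "\<And>r. (p, r) \<in> P \<Longrightarrow> \<exists>s x. (r, s) \<in> P \<and> x \<in> S \<and> s \<in> \<Phi> x"
  shows "p \<in> fr_ex P S \<Phi>"
  using assms unfolding fr_ex_def dense_above_def by blast

lemma fr_exE:
  assumes "p \<in> fr_ex P S \<Phi>" "(p, r) \<in> P"
  obtains s x where "(r, s) \<in> P" "x \<in> S" "s \<in> \<Phi> x"
  using assms unfolding fr_ex_def dense_above_def by blast

section \<open>Possible initial segments of a new real\<close>

text \<open>Says that \<open>p\<close> forces the first \<open>l\<close> values of \<tau> to be
  those of \<open>x\<close>. The segment is given by a total function and a length, so that one
  ground model branch can serve all lengths.\<close>

definition fr_segment :: "'p rel \<Rightarrow> ('v, 'p) rname \<Rightarrow> 'p \<Rightarrow> (nat \<Rightarrow> 'v) \<Rightarrow> nat \<Rightarrow> bool" where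
  "fr_segment P \<tau> p x l \<longleftrightarrow> (\<forall>i<l. p \<in> fr_mem P (i, x i) \<tau>)"

text \<open>The existential in \<open>adds_new_real\<close> provides names only densely often, so
  the whole argument takes place above one condition \<open>q\<close> with a fixed name.\<close>

locale new_real_name =
  fixes P :: "'p rel" and q :: 'p and \<tau> :: "(bool, 'p) rname"
  assumes P: "forcing_notion P"
    and is_function: "q \<in> fr_function P \<tau>"
    and new: "q \<in> fr_not P (fr_in_ground P \<tau>)"
begin

abbreviation "decides \<equiv> fr_segment P \<tau>"

lemmas refl = forcing_refl[OF P]
lemmas trans = forcing_trans[OF P]

lemma q_Field: "q \<in> Field P"
  using new by (simp add: fr_not_def)

lemma decides_mono: "decides p x l \<Longrightarrow> (p, r) \<in> P \<Longrightarrow> decides r x l"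
  by (auto simp: fr_segment_def intro: fr_mem_mono[OF P])

lemma decides_le: "decides p x l \<Longrightarrow> m \<le> l \<Longrightarrow> decides p x m"
  by (auto simp: fr_segment_def)

lemma fr_mem_unique:
  assumes "(q, p) \<in> P" "p \<in> fr_mem P (i, b) \<tau>" "p \<in> fr_mem P (i, c) \<tau>"
  shows "b = c"
proof (rule ccontr)
  assume "b \<noteq> c"
  have "\<forall>yz\<in>{(y, z). y \<noteq> z}. q \<in> (case yz of (y, z) \<Rightarrow>
      fr_not P (fr_and (fr_mem P (i, y) \<tau>) (fr_mem P (i, z) \<tau>)))"
    using is_function unfolding fr_function_def fr_and_def fr_all_def by blast
  from bspec[OF this, of "(b, c)"]
  have "q \<in> fr_not P (fr_and (fr_mem P (i, b) \<tau>) (fr_mem P (i, c) \<tau>))"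
    using \<open>b \<noteq> c\<close> by simp
  then show False using assms by (simp add: fr_not_def fr_and_def)
qed

lemma decides_unique:
  assumes "(q, p) \<in> P" "decides p x l" "decides p y m" "k \<le> l" "k \<le> m"
  shows "restr x k = restr y k"
proof -
  have "x i = y i" if "i < k" for i
    using assms that by (intro fr_mem_unique[OF assms(1), of i]) (auto simp: fr_segment_def)
  then show ?thesis by (simp add: restr_eq_iff)
qed

lemma fr_mem_dense:
  assumes "(q, p) \<in> P"
  shows "\<exists>r b. (p, r) \<in> P \<and> r \<in> fr_mem P (i, b) \<tau>"
proof -
  have "q \<in> fr_ex P UNIV (\<lambda>y. fr_mem P (i, y) \<tau>)"
    using is_function by (simp add: fr_function_def fr_and_def fr_all_def)
  then show ?thesis using assms by (elim fr_exE) blast+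
qed

text \<open>If \<open>p\<close> forced every value of \<open>x\<close>, it would force \<tau> to be
  in the ground model. So some value can be refused, and a Boolean value other than
  \<open>x i\<close> is its negation.\<close>

lemma avoid_branch:
  assumes "(q, p) \<in> P"
  shows "\<exists>r i. (p, r) \<in> P \<and> r \<in> fr_mem P (i, \<not> x i) \<tau>"
proof -
  have pF: "p \<in> Field P" using assms by (rule FieldI2)
  have "\<exists>i. p \<notin> fr_mem P (i, x i) \<tau>"
  proof (rule ccontr)
    assume "\<not> ?thesis"
    then have "r \<in> fr_all P UNIV (\<lambda>n. fr_mem P (n, x n) \<tau>)" if "(p, r) \<in> P" for r
      using that by (auto simp: fr_all_def intro: FieldI2 fr_mem_mono[OF P])
    then have "p \<in> fr_in_ground P \<tau>"
      unfolding fr_in_ground_def using pF refl[OF FieldI2] by (intro fr_exI) blast+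
    then show False using new assms by (auto simp: fr_not_def)
  qed
  \<comment> \<open>Failure of density yields \<open>u\<close> above \<open>p\<close> such that no
    extension of \<open>u\<close> lies above a condition putting \<open>(i, x i)\<close> into
    \<tau>.\<close>
  then obtain i u where u: "(p, u) \<in> P"
    and no: "\<And>r s. (u, r) \<in> P \<Longrightarrow> ((i, x i), s) \<in> \<tau> \<Longrightarrow> (s, r) \<notin> P"
    using pF by (auto simp: fr_mem_def dense_above_def)
  obtain r b where r: "(u, r) \<in> P" "r \<in> fr_mem P (i, b) \<tau>"
    using fr_mem_dense[OF trans[OF assms u]] by blast
  have "b \<noteq> x i"
  proof
    assume "b = x i"
    then obtain s t where "((i, x i), s) \<in> \<tau>" "(s, t) \<in> P" "(r, t) \<in> P"
      using fr_memE[OF P r(2)] by blast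
    then show False using no trans r by blast
  qed
  then have "b = (\<not> x i)" by blast
  then show ?thesis using r u trans by blast
qed

lemma decides_dense:
  assumes "(q, p) \<in> P"
  shows "\<exists>r x. (p, r) \<in> P \<and> decides r x l"
proof (induction l)
  case 0
  show ?case using refl[OF FieldI2[OF assms]] by (auto simp: fr_segment_def)
next
  case (Suc l)
  then obtain r x where r: "(p, r) \<in> P" "decides r x l" by blast
  obtain s b where s: "(r, s) \<in> P" "s \<in> fr_mem P (l, b) \<tau>"
    using fr_mem_dense[OF trans[OF assms r(1)]] by blast
  have "decides s (x(l := b)) (Suc l)"
    using decides_mono[OF r(2) s(1)] s(2) by (auto simp: fr_segment_def less_Suc_eq)
  then show ?case using trans[OF r(1) s(1)] by blast
qed

text \<open>Values are decided one at a time along an increasing sequence of conditions. The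
  sequence need not have an upper bound, so each length has its own witness
  \<open>r\<close>.\<close>

lemma possible_branch:
  assumes "(q, p) \<in> P"
  shows "\<exists>x. \<forall>l. \<exists>r. (p, r) \<in> P \<and> decides r x l"
proof -
  \<comment> \<open>\<open>f n\<close> pairs a condition with the bit decided last. Bit
    \<open>n\<close> is thus stored in \<open>f (Suc n)\<close>, and the bit in \<open>f 0\<close>
    is arbitrary.\<close>
  have "\<exists>f. \<forall>n. ((p, fst (f n)) \<in> P) \<and>
    ((fst (f n), fst (f (Suc n))) \<in> P \<and> fst (f (Suc n)) \<in> fr_mem P (n, snd (f (Suc n))) \<tau>)"
  proof (rule dependent_nat_choice)
    show "\<exists>u. (p, fst u) \<in> P" using refl[OF FieldI2[OF assms]] by auto
  next
    fix u :: "'p \<times> bool" and n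
    assume u: "(p, fst u) \<in> P"
    obtain r b where "(fst u, r) \<in> P" "r \<in> fr_mem P (n, b) \<tau>"
      using fr_mem_dense[OF trans[OF assms u]] by blast
    then show "\<exists>v. (p, fst v) \<in> P \<and> ((fst u, fst v) \<in> P \<and> fst v \<in> fr_mem P (n, snd v) \<tau>)"
      using trans[OF u] by (intro exI[of _ "(r, b)"]) simp
  qed
  then obtain f where f: "\<And>n. (p, fst (f n)) \<in> P" "\<And>n. (fst (f n), fst (f (Suc n))) \<in> P"
    "\<And>n. fst (f (Suc n)) \<in> fr_mem P (n, snd (f (Suc n))) \<tau>"
    by blast
  have "decides (fst (f l)) (\<lambda>n. snd (f (Suc n))) l" for l
  proof (induction l)
    case (Suc l)
    then show ?case
      using decides_mono[OF Suc f(2)] f(3) by (auto simp: fr_segment_def less_Suc_eq)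
  qed (simp add: fr_segment_def)
  then show ?thesis using f(1) by blast
qed

text \<open>Branches are left one by one. A disagreement at length \<open>l\<close> persists when
  the decided segment is lengthened.\<close>

lemma avoid_branches:
  assumes "(q, p) \<in> P" "finite w"
  shows "\<exists>r x l. (p, r) \<in> P \<and> decides r x l \<and> (\<forall>\<eta>\<in>w. restr \<eta> l \<noteq> restr x l)"
  using assms(2)
proof induction
  case empty
  show ?case using decides_dense[OF assms(1)] by blast
next
  case (insert \<eta> w)
  then obtain r x l where r: "(p, r) \<in> P" "decides r x l"
    and w: "\<forall>\<eta>\<in>w. restr \<eta> l \<noteq> restr x l" by blast
  obtain s i where s: "(r, s) \<in> P" "s \<in> fr_mem P (i, \<not> \<eta> i) \<tau>"
    using avoid_branch[OF trans[OF assms(1) r(1)]] by blast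
  have ps: "(p, s) \<in> P" using trans r s by blast
  \<comment> \<open>Long enough to keep the old disagreements and to include position
    \<open>i\<close>.\<close>
  define m where "m = max l (Suc i)"
  obtain t y where t: "(s, t) \<in> P" "decides t y m"
    using decides_dense[OF trans[OF assms(1) ps]] by blast
  have pt: "(p, t) \<in> P" using trans ps t by blast
  have "restr x l = restr y l"
    using decides_unique[OF trans[OF assms(1) pt] decides_mono[OF r(2) trans[OF s(1) t(1)]] t(2)]
    by (simp add: m_def)
  then have "\<forall>\<eta>\<in>w. restr \<eta> m \<noteq> restr y m"
    using w by (fastforce simp: restr_eq_iff m_def)
  moreover have "y i = (\<not> \<eta> i)"
  proof (rule fr_mem_unique[OF trans[OF assms(1) pt]])
    show "t \<in> fr_mem P (i, y i) \<tau>" using t(2) by (simp add: fr_segment_def m_def)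
    show "t \<in> fr_mem P (i, \<not> \<eta> i) \<tau>" using fr_mem_mono[OF P s(2) t(1)] .
  qed
  then have "restr \<eta> m \<noteq> restr y m" by (auto simp: restr_eq_iff m_def intro!: exI[of _ i])
  ultimately show ?case using pt t(2) by blast
qed

section \<open>A generic set of nodes\<close>

text \<open>\<open>A\<close> is the union of the first coordinates of a filter given by
  \<open>MA\<close>. Putting \<open>\<eta> p\<close> into a second coordinate makes it meet
  \<open>A\<close> finitely often. The filter supplies one node off \<open>\<eta> p\<close> for each
  \<open>p\<close>; applying this again to extensions of \<open>p\<close> gives arbitrarily long
  nodes.\<close>

lemma generic_set:
  fixes \<kappa> :: "'k rel"
  assumes MA: "MA \<kappa> Q_circledcirc" and card: "|Field P| \<le>o \<kappa>"
  obtains A where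
    "\<forall>p n. (q, p) \<in> P \<longrightarrow>
        (\<exists>r x l. (p, r) \<in> P \<and> decides r x l \<and> restr x l \<in> A \<and> n \<le> l)" and
    "\<forall>p. (q, p) \<in> P \<longrightarrow>
        (\<exists>x N. \<forall>l. (restr x l \<in> A \<longrightarrow> l < N) \<and> (\<exists>r. (p, r) \<in> P \<and> decides r x l))"
proof -
  define I where "I = {p. (q, p) \<in> P}"
  have "\<forall>p\<in>I. \<exists>x. \<forall>l. \<exists>r. (p, r) \<in> P \<and> decides r x l"
    using possible_branch by (simp add: I_def)
  then obtain \<eta> where \<eta>: "\<And>p l. p \<in> I \<Longrightarrow> \<exists>r. (p, r) \<in> P \<and> decides r (\<eta> p) l"
    by metis
  \<comment> \<open>Such a condition freezes the branch \<open>\<eta> p\<close> and contains a node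
    off it that some extension of \<open>p\<close> forces to be an initial segment of
    \<tau>.\<close>
  define D where "D p = {(a, w). finite a \<and> finite w \<and> \<eta> p \<in> w \<and>
    (\<exists>r x l. (p, r) \<in> P \<and> decides r x l \<and> restr x l \<in> a \<and> restr (\<eta> p) l \<noteq> restr x l)}" for p
  have "I \<subseteq> Field P" by (auto simp: I_def intro: FieldI2)
  then have I: "|I| \<le>o \<kappa>" using card_of_mono1 card ordLeq_transitive by blast
  have "\<exists>F. forcing_filter Q_circledcirc F \<and> (\<forall>p\<in>I. F \<inter> D p \<noteq> {})"
  proof (rule MA_dense_filter[OF MA forcing_notion_Q_circledcirc I])
    fix p assume "p \<in> I"
    show "D p \<subseteq> Field Q_circledcirc" by (auto simp: D_def Field_Q_circledcirc)
    fix c assume "c \<in> Field Q_circledcirc"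
    then obtain a w where c: "c = (a, w)" "finite a" "finite w"
      by (auto simp: Field_Q_circledcirc)
    \<comment> \<open>Avoiding \<open>w\<close> makes adding the new node a legal extension of
      \<open>c\<close>; avoiding \<open>\<eta> p\<close> is demanded by \<open>D p\<close>.\<close>
    obtain r x l where r: "(p, r) \<in> P" "decides r x l"
      "\<forall>\<zeta>\<in>insert (\<eta> p) w. restr \<zeta> l \<noteq> restr x l"
      using avoid_branches[of p "insert (\<eta> p) w"] c \<open>p \<in> I\<close> by (auto simp: I_def)
    have "(insert (restr x l) a, insert (\<eta> p) w) \<in> D p"
      using r c by (auto simp: D_def)
    moreover have "(c, (insert (restr x l) a, insert (\<eta> p) w)) \<in> Q_circledcirc"
      using r(3) c by (auto simp: Q_circledcirc_def restr_eq_iff)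
    ultimately show "\<exists>d\<in>D p. (c, d) \<in> Q_circledcirc" by blast
  qed
  then obtain F where F: "forcing_filter Q_circledcirc F" and meets: "\<And>p. p \<in> I \<Longrightarrow> F \<inter> D p \<noteq> {}"
    by blast
  define A where "A = (\<Union>(a, w)\<in>F. a)"
  have hit: "\<exists>r x l. (p, r) \<in> P \<and> decides r x l \<and> restr x l \<in> A \<and> restr (\<eta> p) l \<noteq> restr x l"
    and fin: "\<exists>N. \<forall>l. restr (\<eta> p) l \<in> A \<longrightarrow> l < N" if "p \<in> I" for p
  proof -
    obtain a w where aw: "(a, w) \<in> F" "(a, w) \<in> D p" using meets \<open>p \<in> I\<close> by fastforce
    show "\<exists>r x l. (p, r) \<in> P \<and> decides r x l \<and> restr x l \<in> A \<and> restr (\<eta> p) l \<noteq> restr x l"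
      using aw unfolding D_def A_def by blast
    show "\<exists>N. \<forall>l. restr (\<eta> p) l \<in> A \<longrightarrow> l < N"
      unfolding A_def by (rule Q_circledcirc_filter_finite[OF F aw(1)]) (use aw(2) in \<open>simp add: D_def\<close>)
  qed
  have inf: "\<exists>r x l. (p, r) \<in> P \<and> decides r x l \<and> restr x l \<in> A \<and> n \<le> l" if "p \<in> I" for p n
  proof (induction n)
    case 0
    then show ?case using hit[OF that] by blast
  next
    case (Suc n)
    then obtain r x l where r: "(p, r) \<in> P" "decides r x l" "n \<le> l" by blast
    then have qr: "(q, r) \<in> P" using that trans by (auto simp: I_def)
    \<comment> \<open>The hit is taken for \<open>r\<close>, which has already decided
      \<open>x\<close> up to \<open>l\<close>, and not for \<open>p\<close>; this makes the new node
      longer than \<open>l\<close>.\<close>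
    then obtain s y m where s: "(r, s) \<in> P" "decides s y m" "restr y m \<in> A"
      and ne: "restr (\<eta> r) m \<noteq> restr y m"
      using hit[of r] by (auto simp: I_def)
    \<comment> \<open>Both \<open>y\<restriction>m\<close> and \<open>x\<restriction>l\<close> are initial segments of \<open>\<tau>\<close>, but only the latter is one of \<open>\<eta>\<^sub>r\<close>.\<close>
    have "l < m"
    proof (rule ccontr)
      assume "\<not> l < m"
      then have "m \<le> l" by simp
      obtain t where t: "(r, t) \<in> P" "decides t (\<eta> r) m" using \<eta>[of r] qr by (auto simp: I_def)
      have "restr (\<eta> r) m = restr x m"
        using decides_unique[OF trans[OF qr t(1)] t(2) decides_mono[OF r(2) t(1)]] \<open>m \<le> l\<close> by simp
      also have "\<dots> = restr y m"
        using decides_unique[OF trans[OF qr s(1)] decides_mono[OF r(2) s(1)] s(2)] \<open>m \<le> l\<close> by simp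
      finally show False using ne by blast
    qed
    then have "Suc n \<le> m" using r(3) by simp
    then show ?case using trans[OF r(1) s(1)] s by blast
  qed
  have "\<exists>x N. \<forall>l. (restr x l \<in> A \<longrightarrow> l < N) \<and> (\<exists>r. (p, r) \<in> P \<and> decides r x l)"
    if "p \<in> I" for p
    using fin[OF that] \<eta>[OF that] by blast
  with inf show thesis unfolding I_def mem_Collect_eq by (intro that allI impI)
qed

section \<open>The name of the unbounded real\<close>

lemma unbounded_name:
  fixes \<kappa> :: "'k rel"
  assumes MA: "MA \<kappa> Q_circledcirc" and card: "|Field P| \<le>o \<kappa>"
  shows "\<exists>\<pi>\<in>rnames P. q \<in> fr_function P \<pi> \<and>
    q \<in> fr_not P (fr_ex P (UNIV :: (nat \<Rightarrow> nat) set) (fr_dominated P \<pi>))"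
proof -
  obtain A where
    inf: "\<forall>p n. (q, p) \<in> P \<longrightarrow>
        (\<exists>r x l. (p, r) \<in> P \<and> decides r x l \<and> restr x l \<in> A \<and> n \<le> l)" and
    fin: "\<forall>p. (q, p) \<in> P \<longrightarrow>
        (\<exists>x N. \<forall>l. (restr x l \<in> A \<longrightarrow> l < N) \<and> (\<exists>r. (p, r) \<in> P \<and> decides r x l))"
    by (rule generic_set[OF assms])
  define next_in where
    "next_in n m x \<longleftrightarrow> n \<le> m \<and> restr x m \<in> A \<and> (\<forall>l. n \<le> l \<and> l < m \<longrightarrow> restr x l \<notin> A)"
    for n m and x :: "nat \<Rightarrow> bool"
  \<comment> \<open>A pair \<open>(n, m)\<close> is attached to every condition above
    \<open>q\<close> that decides enough of \<tau> to see that \<open>m\<close> is the next length,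
    from \<open>n\<close> on, at which \<tau> enters \<open>A\<close>.\<close>
  define \<pi> :: "(nat, 'p) rname" where
    "\<pi> = {((n, m), s). (q, s) \<in> P \<and> (\<exists>x. decides s x m \<and> next_in n m x)}"
  have memE: "\<exists>t x. (p, t) \<in> P \<and> decides t x m \<and> next_in n m x"
    if mem: "p \<in> fr_mem P (n, m) \<pi>" for p n m
  proof -
    obtain s t where st: "((n, m), s) \<in> \<pi>" "(s, t) \<in> P" "(p, t) \<in> P" using fr_memE[OF P mem] .
    then obtain x where "decides s x m" "next_in n m x" by (auto simp: \<pi>_def)
    then show ?thesis using decides_mono[OF _ st(2)] st(3) by blast
  qed
  have "\<pi> \<in> rnames P" by (auto simp: rnames_def \<pi>_def intro: FieldI2)
  moreover have "q \<in> fr_function P \<pi>"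
  proof -
    have "q \<in> fr_ex P UNIV (\<lambda>m. fr_mem P (n, m) \<pi>)" for n
    proof (rule fr_exI[OF q_Field])
      fix p assume p: "(q, p) \<in> P"
      obtain r x l where r: "(p, r) \<in> P" "decides r x l" "restr x l \<in> A" "n \<le> l"
        using inf p by blast
      \<comment> \<open>The minimum is at most \<open>l\<close>, so \<open>r\<close> already decides
        the segment of length \<open>m\<close>.\<close>
      define m where "m = (LEAST m. restr x m \<in> A \<and> n \<le> m)"
      have m: "restr x m \<in> A \<and> n \<le> m" "m \<le> l"
        unfolding m_def by (rule LeastI[of _ l] Least_le, use r in simp)+
      have "restr x k \<notin> A" if "n \<le> k" "k < m" for k
        using not_less_Least[OF that(2)[unfolded m_def]] that(1) by simp
      then have "next_in n m x" using m by (simp add: next_in_def)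
      then have "((n, m), r) \<in> \<pi>"
        using decides_le[OF r(2) m(2)] trans[OF p r(1)] by (auto simp: \<pi>_def)
      then have "r \<in> fr_mem P (n, m) \<pi>" using fr_memI[OF P] refl[OF FieldI2[OF r(1)]] by blast
      then show "\<exists>s m. (p, s) \<in> P \<and> m \<in> UNIV \<and> s \<in> fr_mem P (n, m) \<pi>" using r by blast
    qed
    moreover have "y = z"
      if p: "(q, p) \<in> P" and y: "p \<in> fr_mem P (n, y) \<pi>" and z: "p \<in> fr_mem P (n, z) \<pi>" for n y z p
    proof -
      obtain r x where r: "(p, r) \<in> P" "decides r x y" "next_in n y x"
        using memE[OF y] by blast
      obtain s u where s: "(r, s) \<in> P" "decides s u z" "next_in n z u"
        using memE[OF fr_mem_mono[OF P z r(1)]] by blast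
      have "restr x k = restr u k" if "k \<le> y" "k \<le> z" for k
        using decides_unique[OF _ decides_mono[OF r(2) s(1)] s(2) that]
          trans[OF p trans[OF r(1) s(1)]] by blast
      \<comment> \<open>The two segments agree up to the smaller of \<open>y\<close> and
        \<open>z\<close>; if these differed, the smaller would contradict the minimality of the
        larger.\<close>
      then show "y = z"
        using r(3) s(3) unfolding next_in_def by (metis linorder_neqE_nat less_imp_le order_refl)
    qed
    ultimately show ?thesis
      using q_Field by (auto simp: fr_function_def fr_and_def fr_all_def fr_not_def)
  qed
  moreover have "p \<notin> fr_ex P (UNIV :: (nat \<Rightarrow> nat) set) (fr_dominated P \<pi>)" if p: "(q, p) \<in> P" for p
  proof
    assume "p \<in> fr_ex P (UNIV :: (nat \<Rightarrow> nat) set) (fr_dominated P \<pi>)"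
    then obtain r g where r: "(p, r) \<in> P" "r \<in> fr_dominated P \<pi> g"
      using refl[OF FieldI2[OF p]] by (elim fr_exE)
    then obtain s k where s: "(r, s) \<in> P"
      and bound: "\<And>n. k \<le> n \<Longrightarrow> s \<in> fr_ex P {..g n} (\<lambda>m. fr_mem P (n, m) \<pi>)"
      unfolding fr_dominated_def using refl[OF FieldI2[OF r(1)]]
      by (elim fr_exE) (auto simp: fr_all_def)
    have qs: "(q, s) \<in> P" using p r s trans by blast
    obtain x N where x: "\<forall>l. (restr x l \<in> A \<longrightarrow> l < N) \<and> (\<exists>t. (s, t) \<in> P \<and> decides t x l)"
      using fin qs by blast
    \<comment> \<open>Beyond \<open>k\<close> the bound \<open>g\<close> applies, and from
      \<open>N\<close> on no initial segment of \<open>x\<close> lies in \<open>A\<close>.\<close>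
    define n where "n = max k N"
    \<comment> \<open>With \<tau> agreeing with \<open>x\<close> up to \<open>g n\<close>, a value
      \<open>m\<close> of \<pi> at \<open>n\<close> bounded by \<open>g n\<close> would put
      \<open>restr x m\<close> into \<open>A\<close> although \<open>m\<close> is at least
      \<open>N\<close>.\<close>
    obtain t where t: "(s, t) \<in> P" "decides t x (g n)" using x by blast
    obtain u m where u: "(t, u) \<in> P" "m \<le> g n" "u \<in> fr_mem P (n, m) \<pi>"
      using bound[of n] t(1) by (auto simp: n_def elim: fr_exE)
    obtain v y where v: "(u, v) \<in> P" "decides v y m" "next_in n m y" using memE[OF u(3)] by blast
    have "restr x m = restr y m"
      using decides_unique[OF _ decides_mono[OF t(2) trans[OF u(1) v(1)]] v(2)] u(2)
        trans[OF qs trans[OF t(1) trans[OF u(1) v(1)]]] by blast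
    then have "m < N" using x v(3) by (simp add: next_in_def)
    then show False using v(3) by (simp add: next_in_def n_def)
  qed
  then have "q \<in> fr_not P (fr_ex P (UNIV :: (nat \<Rightarrow> nat) set) (fr_dominated P \<pi>))"
    using q_Field by (simp add: fr_not_def)
  ultimately show ?thesis by (intro bexI conjI)
qed

end

theorem theorem1p13:
  fixes \<kappa> :: "'k rel" and P :: "'p rel"
  assumes "Card_order \<kappa>"
    and "MA \<kappa> Q_circledcirc"
    and "forcing_notion P"
    and "|Field P| \<le>o \<kappa>"
    and "adds_new_real P"
  shows "adds_unbounded_real P"
  unfolding adds_unbounded_real_def forced_def
proof (intro ballI fr_exI)
  \<comment> \<open>The existential need only be witnessed densely, so above \<open>r\<close> one
    may pass to a condition \<open>q\<close> that has its own name for a new real.\<close>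
  fix p r assume "p \<in> Field P" and "(p, r) \<in> P"
  then obtain q \<tau> where q: "(r, q) \<in> P" "\<tau> \<in> rnames P"
    "q \<in> fr_and (fr_function P \<tau>) (fr_not P (fr_in_ground P (\<tau> :: (bool, 'p) rname)))"
    using assms(5) unfolding adds_new_real_def forced_def by (metis (no_types, lifting) fr_exE)
  then interpret new_real_name P q \<tau>
    using assms(3) by unfold_locales (auto simp: fr_and_def)
  show "\<exists>s \<pi>. (r, s) \<in> P \<and> \<pi> \<in> (rnames P :: (nat, 'p) rname set) \<and>
      s \<in> fr_and (fr_function P \<pi>)
        (fr_not P (fr_ex P (UNIV :: (nat \<Rightarrow> nat) set) (fr_dominated P \<pi>)))"
    using unbounded_name[OF assms(2,4)] q(1) by (auto simp: fr_and_def)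
qed

end
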